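(* (i) For every integer $n \ge 3$, the maximum Wiener index of a graph of order $n$ and diameter $2$ equals $(n-1)^2$, and a graph of order $n$ and diameter $2$ attains this value if and only if it is a star $K_{1,n-1}$. (ii) For $n>d\ge 3$ let $W_{n,d}$ denote the maximum Wiener index of a graph of order $n$ and diameter $d$. Then $W_{n,d}=\frac d2 n^2 - d^{3/2}\,\Theta(n^{3/2})$. That is, there exist absolute constants $c_1\ge c_2>0$ such that for every fixed $d\ge 3$ and all sufficiently large $n$ (depending on $d$), $$c_2\, d^{3/2} n^{3/2} \le \frac d2 n^2 - W_{n,d} \le c_1\, d^{3/2} n^{3/2}.$$
   Context: Graphs are finite, simple and undirected; having finite diameter they are connected. $d(u,v)$ is the length of a shortest $u$–$v$ path. The diameter is $\max_{u,v} d(u,v)$. The Wiener index of a graph $G=(V,E)$ is $W(G)=\sum_{\{u,v\}\subset V} d(u,v)$, the sum over all unordered pairs of distinct vertices. *)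

theory Defs
  imports Complex_Main "Graph_Theory.Graph_Theory"
begin

text \<open>
  A finite simple undirected graph is a \<open>pair_graph\<close>: a finite vertex set together with a finite
  symmetric, irreflexive set of vertex pairs, so each undirected edge occurs as two opposite arcs.
\<close>

text \<open>
  Both values below are unspecified when \<open>u\<close> and \<open>v\<close> are not joined by a path; they are only used
  for connected graphs.
\<close>

definition graph_dist :: "'a pair_pre_digraph \<Rightarrow> 'a \<Rightarrow> 'a \<Rightarrow> nat" where
  "graph_dist G u v = (LEAST k. \<exists>p. pre_digraph.apath (with_proj G) u p v \<and> length p = k)"

definition diameter :: "'a pair_pre_digraph \<Rightarrow> nat" where
  "diameter G = Max {graph_dist G u v | u v. u \<in> pverts G \<and> v \<in> pverts G}"

text \<open>The distance of an unordered pair; well defined by \<open>graph_dist_commute\<close> below.\<close>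

definition pair_dist :: "'a pair_pre_digraph \<Rightarrow> 'a set \<Rightarrow> nat" where
  "pair_dist G e = (THE k. \<exists>u v. e = {u, v} \<and> k = graph_dist G u v)"

definition wiener_index :: "'a pair_pre_digraph \<Rightarrow> nat" where
  "wiener_index G = (\<Sum>e | e \<subseteq> pverts G \<and> card e = 2. pair_dist G e)"

definition graphs_of :: "nat \<Rightarrow> nat \<Rightarrow> 'a pair_pre_digraph set" where
  "graphs_of n d = {G. pair_graph G \<and> connected (with_proj G) \<and> card (pverts G) = n \<and> diameter G = d}"

text \<open>
  Up to isomorphism every finite graph has natural numbers as vertices, so the maximum over graphs
  on subsets of \<^typ>\<open>nat\<close> is the maximum over all graphs. The set of values is finite, being bounded
  by \<open>d\<close> times the number of unordered pairs.
\<close>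

definition max_wiener :: "nat \<Rightarrow> nat \<Rightarrow> nat" where
  "max_wiener n d = Max (wiener_index ` (graphs_of n d :: nat pair_pre_digraph set))"

lemma graph_dist_commute:
  assumes "pair_graph G"
  shows "graph_dist G u v = graph_dist G v u"
proof -
  interpret pair_graph G by fact
  have len: "length (rev_path p) = length p" for p :: "('a \<times> 'a) list"
    by (induction p) auto
  have "\<exists>q. apath v q u \<and> length q = length p" if "apath u p v" for u v p
    using that by (intro exI[of _ "rev_path p"]) (auto simp: len apath_def awalk_verts_rev_path)
  then have "(\<exists>p. apath u p v \<and> length p = k) \<longleftrightarrow> (\<exists>p. apath v p u \<and> length p = k)" for k
    by metis
  then show ?thesis by (simp add: graph_dist_def)
qed

lemma pair_dist_doubleton:
  assumes "pair_graph G"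
  shows "pair_dist G {u, v} = graph_dist G u v"
  unfolding pair_dist_def
  by (rule the_equality) (auto simp: doubleton_eq_iff graph_dist_commute[OF assms])

end

theory Submission
  imports Defs
begin

text \<open>
  All estimates concern the deficit \<open>d n\<^sup>2 - 2 W\<close>, the sum of \<open>d - d(u,v)\<close> over ordered pairs.

  For \<open>d = 2\<close> it is \<open>2 n\<close> plus twice the number of edges. A connected graph has at least \<open>n - 1\<close> edges,
  one from each vertex to its predecessor towards a root; if there are no others and the
  root is the midpoint of a pair at distance 2, then diameter 2 leaves no vertex at distance 2 from it.

  The deficit is at least of order \<open>(d n)\<^sup>3\<^sup>/\<^sup>2\<close>: let \<open>\<rho> = \<lfloor>d/3\<rfloor>\<close>. If half of the balls of radius \<open>2\<rho>\<close> have
  more than \<open>\<surd>(d n)\<close> points, the close pairs alone suffice. Otherwise there are about \<open>\<surd>(n/d)\<close> points at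
  pairwise distance more than \<open>2\<rho>\<close>. For every vertex \<open>r\<close>, the geodesics from these points to \<open>r\<close> start with
  disjoint segments of length \<open>\<rho>\<close>, and the \<open>j\<close>-th vertex of a segment has distance at most \<open>d - j\<close> to \<open>r\<close>;
  this gives about \<open>\<surd>(n/d) d\<^sup>2\<close> for each \<open>r\<close>.

  The order is attained by spiders with about \<open>\<surd>(n/d)\<close> legs of length about \<open>d/2\<close> whose remaining vertices are
  distributed evenly as leaves at the ends of the legs.
\<close>

section \<open>Distances in connected graphs\<close>

locale connected_pair_graph = pair_graph G for G :: "'a pair_pre_digraph" +
  assumes connected: "connected (with_proj G)"

lemma (in pair_graph) graph_dist_le_length:
  assumes "awalk u p v"
  shows "graph_dist G u v \<le> length p"
proof -
  \<comment> \<open>With unit arc costs no cycle has negative cost, so cutting the cycles out of a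
    walk does not make it longer.\<close>
  have cost: "awalk_cost (\<lambda>_. 1) q = real (length q)" for q :: "('a \<times> 'a) list"
    by (induction q) auto
  have "awalk_cost (\<lambda>_. 1) (awalk_to_apath p) \<le> awalk_cost (\<lambda>_. 1) p"
    by (intro awalk_to_path_no_neg_cyc_cost[OF assms]) (simp add: cost)
  then have "length (awalk_to_apath p) \<le> length p"
    by (simp add: cost)
  moreover have "graph_dist G u v \<le> length (awalk_to_apath p)"
    unfolding graph_dist_def using apath_awalk_to_apath[OF assms] by (intro Least_le) auto
  ultimately show ?thesis by linarith
qed

lemma (in pair_graph) finite_dist_values:
  "finite {graph_dist G u v | u v. u \<in> pverts G \<and> v \<in> pverts G}"
  by (rule finite_image_set2) (use pair_finite_verts in auto)

lemma (in pair_graph) graph_dist_le_diameter: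
  assumes "u \<in> pverts G" "v \<in> pverts G"
  shows "graph_dist G u v \<le> diameter G"
  unfolding diameter_def using assms by (intro Max_ge finite_dist_values) auto

lemma (in pair_graph) diameter_eqI:
  assumes "\<And>u v. u \<in> pverts G \<Longrightarrow> v \<in> pverts G \<Longrightarrow> graph_dist G u v \<le> d"
    and "u \<in> pverts G" "v \<in> pverts G" "d \<le> graph_dist G u v"
  shows "diameter G = d"
proof (rule antisym)
  show "diameter G \<le> d"
    unfolding diameter_def using assms by (subst Max_le_iff) (auto intro: finite_dist_values)
  show "d \<le> diameter G"
    using graph_dist_le_diameter[OF assms(2,3)] assms(4) by simp
qed

text \<open>The source of all lower bounds for distances in spiders: a potential that rises by at
  most 1 along each arc bounds walk lengths from below.\<close>

lemma (in pair_graph) lipschitz_awalk: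
  fixes f :: "'a \<Rightarrow> nat"
  assumes "awalk u p v" and "\<And>x y. (x, y) \<in> parcs G \<Longrightarrow> f y \<le> f x + 1"
  shows "f v \<le> f u + length p"
  using assms(1)
proof (induction p arbitrary: u)
  case Nil
  then show ?case by (auto simp: awalk_Nil_iff)
next
  case (Cons e p)
  then have "(u, snd e) \<in> parcs G" "awalk (snd e) p v"
    by (auto simp: awalk_Cons_iff)
  with Cons.IH assms(2) show ?case by fastforce
qed

context connected_pair_graph
begin

lemma ex_awalk:
  assumes "u \<in> pverts G" "v \<in> pverts G"
  shows "\<exists>p. awalk u p v"
  using symmetric_connected_imp_strongly_connected[OF pair_sym_arcs connected] assms
  by (auto simp: strongly_connected_def reachable_awalk)

lemma ex_shortest_awalk:
  assumes "u \<in> pverts G" "v \<in> pverts G"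
  obtains p where "awalk u p v" "length p = graph_dist G u v"
proof -
  obtain q where "awalk u q v" using ex_awalk[OF assms] by blast
  then have "\<exists>p. apath u p v \<and> length p = length (awalk_to_apath q)"
    using apath_awalk_to_apath by blast
  from LeastI[where P="\<lambda>k. \<exists>p. apath u p v \<and> length p = k", OF this]
  obtain p where "apath u p v" "length p = graph_dist G u v"
    unfolding graph_dist_def by blast
  then show thesis using that awalkI_apath by blast
qed

lemma graph_dist_triangle:
  assumes "u \<in> pverts G" "v \<in> pverts G" "w \<in> pverts G"
  shows "graph_dist G u w \<le> graph_dist G u v + graph_dist G v w"
proof -
  obtain p q where "awalk u p v" "length p = graph_dist G u v"
    "awalk v q w" "length q = graph_dist G v w"
    using assms ex_shortest_awalk by metis
  then show ?thesis
    using graph_dist_le_length[OF awalk_appendI, of u p v q w] by simp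
qed

lemma graph_dist_self [simp]: "u \<in> pverts G \<Longrightarrow> graph_dist G u u = 0"
  using graph_dist_le_length[of u "[]" u] by (simp add: awalk_Nil_iff)

lemma graph_dist_eq_0_iff:
  assumes "u \<in> pverts G" "v \<in> pverts G"
  shows "graph_dist G u v = 0 \<longleftrightarrow> u = v"
  using ex_shortest_awalk[OF assms] assms
  by (metis awalk_empty_ends graph_dist_self length_0_conv)

lemma graph_dist_arc:
  assumes "(u, v) \<in> parcs G"
  shows "graph_dist G u v = 1"
proof -
  have "u \<in> pverts G" "v \<in> pverts G" "u \<noteq> v"
    using assms wellformed' no_loops' by auto
  moreover have "graph_dist G u v \<le> 1"
    using graph_dist_le_length[of u "[(u, v)]" v] assms calculation by (simp add: awalk_simps)
  ultimately show ?thesis using graph_dist_eq_0_iff[of u v] by linarith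
qed

lemma graph_dist_eq_1_iff:
  assumes "u \<in> pverts G" "v \<in> pverts G"
  shows "graph_dist G u v = 1 \<longleftrightarrow> (u, v) \<in> parcs G"
proof
  assume "graph_dist G u v = 1"
  then obtain p where "awalk u p v" "length p = 1"
    using ex_shortest_awalk[OF assms] by metis
  then show "(u, v) \<in> parcs G"
    by (auto simp: length_Suc_conv awalk_simps)
qed (rule graph_dist_arc)

text \<open>A shortest walk is cut after \<open>j\<close> arcs. Neither piece can be shorter than
  its number of arcs without violating the triangle inequality.\<close>

lemma geodesic_vertex:
  assumes "u \<in> pverts G" "v \<in> pverts G" "j \<le> graph_dist G u v"
  shows "\<exists>w\<in>pverts G. graph_dist G u w = j \<and> graph_dist G w v = graph_dist G u v - j"
proof -
  obtain p where p: "awalk u p v" "length p = graph_dist G u v"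
    using ex_shortest_awalk assms by metis
  define w where "w = awlast u (take j p)"
  have w: "awalk u (take j p) w" "awalk w (drop j p) v"
    using p(1) awalk_append_iff[of u "take j p" "drop j p" v] unfolding w_def by auto
  then have wV: "w \<in> pverts G" using awalk_hd_in_verts by blast
  have "graph_dist G u w \<le> j" "graph_dist G w v \<le> graph_dist G u v - j"
    using graph_dist_le_length[OF w(1)] graph_dist_le_length[OF w(2)] p(2) assms(3) by auto
  with graph_dist_triangle[OF assms(1) wV assms(2)] assms(3) wV show ?thesis
    by (intro bexI[of _ w]) auto
qed

end

section \<open>Distance deficit and graphs of diameter 2\<close>

text \<open>Truncated subtraction is exact here, since no distance exceeds the diameter. The term
  \<open>u = v\<close> is kept so that the total over all \<open>v\<close> complements
  \<open>2 * wiener_index G\<close> to exactly \<open>d * n^2\<close>.\<close>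

definition dist_deficit :: "'a pair_pre_digraph \<Rightarrow> 'a \<Rightarrow> nat" where
  "dist_deficit G v = (\<Sum>u\<in>pverts G. diameter G - graph_dist G u v)"

context connected_pair_graph
begin

lemma sum_dist_ordered_pairs:
  "(\<Sum>v\<in>pverts G. \<Sum>u\<in>pverts G. graph_dist G u v) = 2 * wiener_index G"
proof -
  define S where "S = {(u, v). u \<in> pverts G \<and> v \<in> pverts G \<and> u \<noteq> v}"
  define E where "E = {e. e \<subseteq> pverts G \<and> card e = 2}"
  have fin: "finite (pverts G \<times> pverts G)" using pair_finite_verts by simp
  have "S \<subseteq> pverts G \<times> pverts G" by (auto simp: S_def)
  then have finS: "finite S" using fin finite_subset by blast
  have finE: "finite E" using pair_finite_verts by (simp add: E_def)
  have "(\<Sum>v\<in>pverts G. \<Sum>u\<in>pverts G. graph_dist G u v)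
      = (\<Sum>(u, v)\<in>pverts G \<times> pverts G. graph_dist G u v)"
    by (subst sum.swap) (simp add: sum.cartesian_product)
  also have "\<dots> = (\<Sum>(u, v)\<in>S. graph_dist G u v)"
    using fin by (intro sum.mono_neutral_right) (auto simp: S_def)
  \<comment> \<open>Ordered pairs are grouped by their underlying set; each fibre consists of the
    two orientations of one pair.\<close>
  also have "\<dots> = (\<Sum>e\<in>E. \<Sum>(u, v)\<in>{p \<in> S. (\<lambda>(u, v). {u, v}) p = e}. graph_dist G u v)"
    by (rule sum.group[symmetric, OF finS finE]) (auto simp: S_def E_def)
  also have "\<dots> = (\<Sum>e\<in>E. 2 * pair_dist G e)"
  proof (rule sum.cong[OF refl])
    fix e assume "e \<in> E"
    then obtain a b where ab: "e = {a, b}" "a \<noteq> b" "a \<in> pverts G" "b \<in> pverts G"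
      by (auto simp: E_def card_2_iff)
    then have "{p \<in> S. (\<lambda>(u, v). {u, v}) p = e} = {(a, b), (b, a)}"
      by (auto simp: S_def doubleton_eq_iff)
    then show "(\<Sum>(u, v)\<in>{p \<in> S. (\<lambda>(u, v). {u, v}) p = e}. graph_dist G u v) = 2 * pair_dist G e"
      using ab graph_dist_commute[OF pair_graph, of a b]
      by (simp add: pair_dist_doubleton[OF pair_graph])
  qed
  also have "\<dots> = 2 * wiener_index G"
    by (simp add: wiener_index_def E_def sum_distrib_left)
  finally show ?thesis .
qed

lemma sum_dist_deficit:
  "(\<Sum>v\<in>pverts G. dist_deficit G v) + 2 * wiener_index G = diameter G * (card (pverts G))\<^sup>2"
proof -
  have "(\<Sum>v\<in>pverts G. dist_deficit G v) + 2 * wiener_index G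
      = (\<Sum>v\<in>pverts G. \<Sum>u\<in>pverts G. (diameter G - graph_dist G u v) + graph_dist G u v)"
    by (simp add: dist_deficit_def sum.distrib flip: sum_dist_ordered_pairs)
  also have "\<dots> = (\<Sum>v\<in>pverts G. \<Sum>u\<in>pverts G. diameter G)"
    using graph_dist_le_diameter by (intro sum.cong refl) simp
  finally show ?thesis by (simp add: power2_eq_square)
qed

text \<open>In diameter 2 an ordered pair has deficit 2 on the diagonal, 1 on an arc and 0
  otherwise.\<close>

lemma wiener_index_diameter_2:
  assumes "diameter G = 2"
  shows "2 * wiener_index G + card (parcs G) + 2 * card (pverts G) = 2 * (card (pverts G))\<^sup>2"
proof -
  let ?V = "pverts G"
  have "(\<Sum>v\<in>?V. dist_deficit G v)
      = (\<Sum>v\<in>?V. \<Sum>u\<in>?V. (if u = v then 2 else 0) + (if (u, v) \<in> parcs G then 1 else 0))"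
    unfolding dist_deficit_def
  proof (intro sum.cong refl)
    fix u v assume uv: "v \<in> ?V" "u \<in> ?V"
    show "diameter G - graph_dist G u v
        = (if u = v then 2 else 0) + (if (u, v) \<in> parcs G then 1 else 0)"
      using graph_dist_le_diameter[OF uv(2,1)] graph_dist_eq_0_iff[OF uv(2,1)]
        graph_dist_eq_1_iff[OF uv(2,1)] assms
      by (cases "graph_dist G u v = 0 \<or> graph_dist G u v = 1") (auto dest: no_loops')
  qed
  also have "\<dots> = 2 * card ?V + (\<Sum>v\<in>?V. \<Sum>u\<in>?V. if (u, v) \<in> parcs G then 1 else 0)"
    using pair_finite_verts by (simp only: sum.distrib) (simp add: sum.delta)
  also have "(\<Sum>v\<in>?V. \<Sum>u\<in>?V. if (u, v) \<in> parcs G then 1 else 0)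
      = (\<Sum>u\<in>?V. \<Sum>v\<in>?V. if (u, v) \<in> parcs G then 1 else (0::nat))"
    by (rule sum.swap)
  also have "(\<Sum>u\<in>?V. \<Sum>v\<in>?V. if (u, v) \<in> parcs G then 1 else 0)
      = (\<Sum>p\<in>?V \<times> ?V. if p \<in> parcs G then 1 else (0::nat))"
    by (simp add: sum.cartesian_product case_prod_unfold)
  also have "\<dots> = card (?V \<times> ?V \<inter> parcs G)"
    using pair_finite_verts by (simp flip: sum.inter_restrict)
  also have "?V \<times> ?V \<inter> parcs G = parcs G"
    using wellformed' by auto
  finally show ?thesis
    using sum_dist_deficit assms by simp
qed

section \<open>Breadth-first trees, the number of arcs, and stars\<close>

lemma ex_parent:
  assumes "r \<in> pverts G"
  shows "\<exists>p. \<forall>v\<in>pverts G - {r}. (p v, v) \<in> parcs G \<and> graph_dist G r v = graph_dist G r (p v) + 1"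
proof (intro bchoice ballI)
  fix v assume v: "v \<in> pverts G - {r}"
  then have "graph_dist G r v \<noteq> 0" using graph_dist_eq_0_iff assms by auto
  with geodesic_vertex[of r v "graph_dist G r v - 1"] assms v
  obtain w where w: "w \<in> pverts G" "graph_dist G r w = graph_dist G r v - 1" "graph_dist G w v = 1"
    by auto
  then show "\<exists>w. (w, v) \<in> parcs G \<and> graph_dist G r v = graph_dist G r w + 1"
    using \<open>graph_dist G r v \<noteq> 0\<close> v graph_dist_eq_1_iff[of w v] by auto
qed

text \<open>\<open>T\<close> is a breadth-first tree with both orientations of each edge. An arc in
  both families would lead away from \<open>r\<close> and towards \<open>r\<close> at once, so
  nothing is counted twice.\<close>

lemma card_parcs_parent:
  assumes r: "r \<in> pverts G"
    and p: "\<And>v. v \<in> pverts G - {r} \<Longrightarrow> (p v, v) \<in> parcs G \<and> graph_dist G r v = graph_dist G r (p v) + 1"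
  defines "T \<equiv> (\<lambda>v. (p v, v)) ` (pverts G - {r}) \<union> (\<lambda>v. (v, p v)) ` (pverts G - {r})"
  shows "T \<subseteq> parcs G" "card T = 2 * (card (pverts G) - 1)"
proof -
  show "T \<subseteq> parcs G"
    using p arcs_symmetric by (auto simp: T_def)
  have "(\<lambda>v. (p v, v)) ` (pverts G - {r}) \<inter> (\<lambda>v. (v, p v)) ` (pverts G - {r}) = {}"
  proof (rule equals0I)
    fix e assume "e \<in> (\<lambda>v. (p v, v)) ` (pverts G - {r}) \<inter> (\<lambda>v. (v, p v)) ` (pverts G - {r})"
    then obtain u v where "u \<in> pverts G - {r}" "v \<in> pverts G - {r}" "e = (p u, u)" "e = (v, p v)"
      by (elim IntE imageE) (rule that)
    then have "graph_dist G r u = graph_dist G r v + 1" "graph_dist G r v = graph_dist G r u + 1"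
      using p[of u] p[of v] by (metis prod.inject)+
    then show False by simp
  qed
  moreover have "inj_on (\<lambda>v. (p v, v)) (pverts G - {r})" "inj_on (\<lambda>v. (v, p v)) (pverts G - {r})"
    by (auto intro: inj_onI)
  ultimately show "card T = 2 * (card (pverts G) - 1)"
    using pair_finite_verts r by (simp add: T_def card_Un_disjoint card_image)
qed

lemma card_parcs_ge: "2 * (card (pverts G) - 1) \<le> card (parcs G)"
proof -
  have "pverts G \<noteq> {}"
    using connected by (auto simp: connected_conv)
  then obtain r where r: "r \<in> pverts G" by blast
  then obtain p where "\<And>v. v \<in> pverts G - {r} \<Longrightarrow>
      (p v, v) \<in> parcs G \<and> graph_dist G r v = graph_dist G r (p v) + 1"
    using ex_parent by blast
  then show ?thesis
    using card_mono[OF pair_finite_arcs card_parcs_parent(1)[of r p]] card_parcs_parent(2)[of r p] r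
    by simp
qed

text \<open>With so few arcs the graph is its own breadth-first tree from any root. Rooted at the
  midpoint \<open>r\<close> of a pair at distance 2, it has two branches, so a vertex at level 2
  would be at distance more than 2 from a neighbour of \<open>r\<close> in another branch.\<close>

lemma star_if_few_arcs:
  assumes diam: "diameter G = 2" and card: "card (parcs G) = 2 * (card (pverts G) - 1)"
  shows "K\<^bsub>1,card (pverts G) - 1\<^esub> (with_proj G)"
proof -
  have "pverts G \<noteq> {}"
    using connected by (auto simp: connected_conv)
  then have "2 \<in> {graph_dist G u v | u v. u \<in> pverts G \<and> v \<in> pverts G}"
    using diam Max_in[OF finite_dist_values] unfolding diameter_def by auto
  then obtain a b where ab: "a \<in> pverts G" "b \<in> pverts G" "graph_dist G a b = 2"
    by auto
  with geodesic_vertex[of a b 1] obtain r where r: "r \<in> pverts G"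
    "graph_dist G a r = 1" "graph_dist G r b = 1" by auto
  then have ra: "graph_dist G r a = 1"
    by (simp add: graph_dist_commute[OF pair_graph])
  have "a \<noteq> b" using ab by auto
  obtain p where p: "\<And>v. v \<in> pverts G - {r} \<Longrightarrow>
      (p v, v) \<in> parcs G \<and> graph_dist G r v = graph_dist G r (p v) + 1"
    using ex_parent[OF r(1)] by blast
  have parcs: "parcs G = (\<lambda>v. (p v, v)) ` (pverts G - {r}) \<union> (\<lambda>v. (v, p v)) ` (pverts G - {r})"
    using card_subset_eq[OF pair_finite_arcs card_parcs_parent(1)[of r p]]
      card_parcs_parent(2)[of r p] r(1) p card by simp
  have parent_r: "p v = r" if v: "v \<in> pverts G" "v \<noteq> r" for v
  proof (rule ccontr)
    assume "p v \<noteq> r"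
    have pv: "p v \<in> pverts G" "graph_dist G r v = graph_dist G r (p v) + 1"
      using p[of v] v wellformed' by auto
    then have dist_v: "graph_dist G r (p v) = 1" "graph_dist G r v = 2"
      using graph_dist_eq_0_iff[OF r(1) pv(1)] \<open>p v \<noteq> r\<close> graph_dist_le_diameter[OF r(1) v(1)] diam
      by auto
    \<comment> \<open>Both \<open>a\<close> and \<open>b\<close> are neighbours of \<open>r\<close>,
      and at most one of them is \<open>p v\<close>.\<close>
    obtain u where u: "u \<in> pverts G" "u \<noteq> p v" "graph_dist G r u = 1"
      using ab(1,2) r(3) ra \<open>a \<noteq> b\<close> by metis
    have adj: "x = p v" if "(v, x) \<in> parcs G" for x
    proof (rule ccontr)
      assume "x \<noteq> p v"
      then have "v = p x" "x \<in> pverts G - {r}" using that parcs by auto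
      then have "graph_dist G r x = 3" using p[of x] dist_v by auto
      then show False
        using graph_dist_le_diameter[of r x] r(1) \<open>x \<in> pverts G - {r}\<close> diam by auto
    qed
    have "v \<noteq> u" using u dist_v by auto
    then have "graph_dist G v u \<noteq> 0" using graph_dist_eq_0_iff v(1) u(1) by auto
    moreover have "graph_dist G v u \<noteq> 1" using graph_dist_eq_1_iff v(1) u(1,2) adj by auto
    ultimately have "graph_dist G v u = 2"
      using graph_dist_le_diameter[OF v(1) u(1)] diam by linarith
    with geodesic_vertex[of v u 1] v(1) u(1) obtain x where x: "x \<in> pverts G"
      "graph_dist G v x = 1" "graph_dist G x u = 1" by auto
    then have "(v, x) \<in> parcs G" "(x, u) \<in> parcs G"
      using graph_dist_eq_1_iff v(1) u(1) by auto
    \<comment> \<open>This arc joins two vertices at level 1, whereas tree arcs join consecutive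
      levels.\<close>
    then have "(p v, u) \<in> parcs G" using adj by auto
    then have "p u = p v \<and> u \<noteq> r \<or> p (p v) = u \<and> p v \<noteq> r" using parcs by auto
    then show False
      using p[of u] p[of "p v"] u(1,3) dist_v pv(1) by auto
  qed
  have "parcs G = {r} \<times> (pverts G - {r}) \<union> (pverts G - {r}) \<times> {r}"
    unfolding parcs using parent_r by force
  moreover have "pverts G = {r} \<union> (pverts G - {r})" "{r} \<inter> (pverts G - {r}) = {}"
    using r(1) by auto
  moreover have "card {r} = 1" "card (pverts G - {r}) = card (pverts G) - 1"
    using r(1) by simp_all
  ultimately show ?thesis
    unfolding complete_bipartite_digraph_pair_def
    using pair_finite_verts by blast
qed

end

lemma card_parcs_complete_bipartite:
  assumes "K\<^bsub>m,n\<^esub> (with_proj G)"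
  shows "card (parcs G) = 2 * m * n"
proof -
  obtain U V where UV: "finite (pverts G)" "pverts G = U \<union> V" "U \<inter> V = {}" "card U = m"
    "card V = n" "parcs G = U \<times> V \<union> V \<times> U"
    using assms unfolding complete_bipartite_digraph_pair_def by blast
  then have "U \<times> V \<inter> V \<times> U = {}" "finite U" "finite V" by auto
  then show ?thesis
    using UV by (simp add: card_Un_disjoint card_cartesian_product)
qed

section \<open>Lower bound for the deficit\<close>

lemma gauss_sum_twice: "2 * (\<Sum>j\<le>m. j) = m * (m + 1 :: nat)"
  by (induction m) simp_all

context connected_pair_graph
begin

text \<open>Greedy choice: a further point is either within \<open>m\<close> of the chosen ones,
  hence covered, or can be added to them.\<close>

lemma ex_maximal_separated:
  assumes "finite A" "A \<subseteq> pverts G"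
  shows "\<exists>C\<subseteq>A. (\<forall>c\<in>C. \<forall>c'\<in>C. c \<noteq> c' \<longrightarrow> m < graph_dist G c c')
    \<and> A \<subseteq> (\<Union>c\<in>C. {u \<in> pverts G. graph_dist G u c \<le> m})"
  using assms
proof (induction A rule: finite_induct)
  case empty
  then show ?case by auto
next
  case (insert a A)
  then obtain C where C: "C \<subseteq> A" "\<forall>c\<in>C. \<forall>c'\<in>C. c \<noteq> c' \<longrightarrow> m < graph_dist G c c'"
    "A \<subseteq> (\<Union>c\<in>C. {u \<in> pverts G. graph_dist G u c \<le> m})"
    by auto
  show ?case
  proof (cases "\<exists>c\<in>C. graph_dist G a c \<le> m")
    case True
    with C insert.prems show ?thesis by (intro exI[of _ C]) auto
  next
    case False
    with C insert.prems show ?thesis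
      using graph_dist_commute[OF pair_graph]
      by (intro exI[of _ "insert a C"]) (auto simp: not_le)
  qed
qed

lemma dist_deficit_ge_ball:
  assumes "v \<in> pverts G"
  shows "card {u \<in> pverts G. graph_dist G u v \<le> m} * (diameter G - m) \<le> dist_deficit G v"
proof -
  have "card {u \<in> pverts G. graph_dist G u v \<le> m} * (diameter G - m)
      \<le> (\<Sum>u | u \<in> pverts G \<and> graph_dist G u v \<le> m. diameter G - graph_dist G u v)"
    using sum_bounded_below[of "{u \<in> pverts G. graph_dist G u v \<le> m}" "diameter G - m"
        "\<lambda>u. diameter G - graph_dist G u v"] by (simp add: diff_le_mono2)
  also have "\<dots> \<le> dist_deficit G v"
    unfolding dist_deficit_def using pair_finite_verts by (intro sum_mono2) auto
  finally show ?thesis .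
qed

lemma dist_deficit_ge_separated:
  assumes C: "C \<subseteq> pverts G" and r: "r \<in> pverts G"
    and sep: "\<forall>c\<in>C. \<forall>c'\<in>C. c \<noteq> c' \<longrightarrow> 2 * \<rho> < graph_dist G c c'"
  shows "(card C - 1) * (\<Sum>j\<le>\<rho>. j) \<le> dist_deficit G r"
proof -
  define C' where "C' = {c \<in> C. \<rho> \<le> graph_dist G c r}"
  have finC: "finite C" using C pair_finite_verts finite_subset by blast
  \<comment> \<open>Two points of \<open>C\<close> closer than \<open>\<rho>\<close> to
    \<open>r\<close> would be within \<open>2 * \<rho>\<close> of each other. So at most one point
    is lost, which accounts for \<open>card C - 1\<close>.\<close>
  have "\<exists>x. C - C' \<subseteq> {x}"
  proof (cases "C - C' = {}")
    case False
    then obtain x where x: "x \<in> C - C'" by blast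
    have "y = x" if y: "y \<in> C - C'" for y
    proof (rule ccontr)
      assume "y \<noteq> x"
      then have "2 * \<rho> < graph_dist G y x" using sep x y by auto
      also have "\<dots> \<le> graph_dist G y r + graph_dist G x r"
        using graph_dist_triangle[of y r x] graph_dist_commute[OF pair_graph, of r x] C r x y by auto
      also have "\<dots> \<le> 2 * \<rho>" using x y by (auto simp: C'_def)
      finally show False by simp
    qed
    then show ?thesis by blast
  qed auto
  then obtain x where "C - C' \<subseteq> {x}" by blast
  then have "C \<subseteq> insert x C'" by blast
  moreover have finC': "finite C'" using finC by (simp add: C'_def)
  ultimately have "card C \<le> card (insert x C')" by (simp add: card_mono)
  also have "\<dots> \<le> Suc (card C')" using finC' by (simp add: card_insert_if)
  finally have cardC': "card C - 1 \<le> card C'" by simp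
  \<comment> \<open>For fixed \<open>c\<close> the vertices chosen for different \<open>j\<close>
    need not lie on a common geodesic; only their distances to \<open>c\<close> and \<open>r\<close>
    matter.\<close>
  have "\<forall>c\<in>C'. \<forall>j\<in>{..\<rho>}. \<exists>w. w \<in> pverts G \<and> graph_dist G c w = j
      \<and> graph_dist G w r = graph_dist G c r - j"
  proof (intro ballI)
    fix c j assume "c \<in> C'" "j \<in> {..\<rho>}"
    then have "c \<in> pverts G" "j \<le> graph_dist G c r" using C by (auto simp: C'_def)
    then show "\<exists>w. w \<in> pverts G \<and> graph_dist G c w = j \<and> graph_dist G w r = graph_dist G c r - j"
      using geodesic_vertex[OF _ r] by blast
  qed
  then obtain g where g: "\<And>c j. c \<in> C' \<Longrightarrow> j \<le> \<rho> \<Longrightarrow> g c j \<in> pverts G"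
    "\<And>c j. c \<in> C' \<Longrightarrow> j \<le> \<rho> \<Longrightarrow> graph_dist G c (g c j) = j"
    "\<And>c j. c \<in> C' \<Longrightarrow> j \<le> \<rho> \<Longrightarrow> graph_dist G (g c j) r = graph_dist G c r - j"
    unfolding bchoice_iff by auto
  \<comment> \<open>The balls of radius \<open>\<rho>\<close> around the points of \<open>C\<close> are disjoint, so the initial segments of
    the geodesics towards \<open>r\<close> do not overlap.\<close>
  have inj: "inj_on (\<lambda>(c, j). g c j) (C' \<times> {..\<rho>})"
  proof (rule inj_onI, clarsimp)
    fix c j c' j' assume *: "c \<in> C'" "j \<le> \<rho>" "c' \<in> C'" "j' \<le> \<rho>" "g c j = g c' j'"
    have CV: "c \<in> pverts G" "c' \<in> pverts G" using * C by (auto simp: C'_def)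
    have "graph_dist G c c' \<le> graph_dist G c (g c j) + graph_dist G c' (g c' j')"
      using graph_dist_triangle[OF CV(1) g(1)[OF *(1,2)] CV(2)] *(5)
        graph_dist_commute[OF pair_graph, of c' "g c' j'"] by simp
    also have "\<dots> \<le> 2 * \<rho>" using g(2)[OF *(1,2)] g(2)[OF *(3,4)] *(2,4) by linarith
    finally have "\<not> 2 * \<rho> < graph_dist G c c'" by simp
    then have "c = c'" using sep *(1,3) unfolding C'_def by blast
    with * g(2) show "c = c' \<and> j = j'" by metis
  qed
  have "(card C - 1) * (\<Sum>j\<le>\<rho>. j) \<le> card C' * (\<Sum>j\<le>\<rho>. j)"
    using cardC' by (rule mult_right_mono) simp
  also have "\<dots> = (\<Sum>(c, j)\<in>C' \<times> {..\<rho>}. j)"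
    by (simp flip: sum.cartesian_product)
  also have "\<dots> \<le> (\<Sum>(c, j)\<in>C' \<times> {..\<rho>}. diameter G - graph_dist G (g c j) r)"
  proof (rule sum_mono, clarsimp)
    fix c j assume *: "c \<in> C'" "j \<le> \<rho>"
    then have "graph_dist G c r \<le> diameter G" "\<rho> \<le> graph_dist G c r"
      using graph_dist_le_diameter r C by (auto simp: C'_def)
    then show "j \<le> diameter G - graph_dist G (g c j) r" using g(3)[OF *] * by linarith
  qed
  also have "\<dots> = (\<Sum>u\<in>(\<lambda>(c, j). g c j) ` (C' \<times> {..\<rho>}). diameter G - graph_dist G u r)"
    by (subst sum.reindex[OF inj]) (simp add: case_prod_unfold)
  also have "\<dots> \<le> dist_deficit G r"
    unfolding dist_deficit_def using g(1) pair_finite_verts by (intro sum_mono2) auto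
  finally show ?thesis .
qed

lemma sum_dist_deficit_ge:
  assumes d: "diameter G \<ge> 3" and large: "card (pverts G) \<ge> 16 * diameter G"
  defines "x \<equiv> real (diameter G) * real (card (pverts G))"
  shows "x * sqrt x / 200 \<le> real (\<Sum>v\<in>pverts G. dist_deficit G v)"
proof -
  define n where "n = card (pverts G)"
  define d where "d = diameter G"
  define \<rho> where "\<rho> = d div 3"
  define ball where "ball v = {u \<in> pverts G. graph_dist G u v \<le> 2 * \<rho>}" for v
  define s where "s = sqrt x"
  define A where "A = {v \<in> pverts G. card (ball v) \<le> s}"
  have d3: "d \<ge> 3" and nd: "n \<ge> 16 * d" using assms by (simp_all add: d_def n_def)
  have x: "x = real d * real n" by (simp add: x_def d_def n_def)
  have "x > 0" using d3 nd by (simp add: x)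
  then have s: "s > 0" "s * s = real d * real n"
    using x by (simp_all add: s_def)
  have A: "A \<subseteq> pverts G" "finite A" using pair_finite_verts by (auto simp: A_def)
  have "\<rho> \<ge> 1" "3 * \<rho> \<le> d" "d \<le> 3 * \<rho> + 2"
    using d3 by (auto simp: \<rho>_def)
  \<comment> \<open>The worst case of the first bound is \<open>d = 5\<close>,
    \<open>\<rho> = 1\<close>; the second one follows from
    \<open>3 * \<rho> \<le> d\<close>.\<close>
  then have \<rho>: "real \<rho> \<ge> real d / 5" "3 * (d - 2 * \<rho>) \<ge> d"
    by linarith+
  show ?thesis
  proof (cases "2 * card A \<le> n")
    case True
    \<comment> \<open>At least half of the vertices have balls with more than \<open>s\<close>
      points, each of deficit at least \<open>d / 3\<close>.\<close>
    have "x * s / 6 \<le> (n / 2) * (s * (d / 3))"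
      by (simp add: x)
    also have "\<dots> \<le> card (pverts G - A) * (s * (d / 3))"
      using True A s(1) pair_finite_verts
      by (intro mult_right_mono) (auto simp: card_Diff_subset n_def of_nat_diff card_mono)
    also have "\<dots> = (\<Sum>v\<in>pverts G - A. s * (d / 3))" by simp
    also have "\<dots> \<le> (\<Sum>v\<in>pverts G - A. real (dist_deficit G v))"
    proof (rule sum_mono)
      fix v assume v: "v \<in> pverts G - A"
      have "s * (d / 3) \<le> card (ball v) * real (d - 2 * \<rho>)"
        using v s(1) \<rho>(2) by (intro mult_mono) (auto simp: A_def)
      also have "\<dots> \<le> dist_deficit G v"
        using dist_deficit_ge_ball[of v "2 * \<rho>"] v unfolding ball_def d_def
        by (simp only: DiffD1 of_nat_le_iff flip: of_nat_mult)
      finally show "s * (d / 3) \<le> dist_deficit G v" .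
    qed
    also have "\<dots> \<le> (\<Sum>v\<in>pverts G. real (dist_deficit G v))"
      using pair_finite_verts by (intro sum_mono2) auto
    finally have "x * s / 6 \<le> real (\<Sum>v\<in>pverts G. dist_deficit G v)" by simp
    moreover have "x * s / 200 \<le> x * s / 6"
      using \<open>x > 0\<close> s(1) by (intro divide_left_mono) auto
    ultimately show ?thesis by (simp add: s_def)
  next
    case False
    obtain C where C: "C \<subseteq> A" "\<forall>c\<in>C. \<forall>c'\<in>C. c \<noteq> c' \<longrightarrow> 2 * \<rho> < graph_dist G c c'"
      "A \<subseteq> (\<Union>c\<in>C. ball c)"
      using ex_maximal_separated[OF A(2,1), of "2 * \<rho>"] unfolding ball_def by auto
    have finC: "finite C" using C(1) A(2) finite_subset by blast
    have "finite (\<Union>c\<in>C. ball c)"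
      using pair_finite_verts finC by (auto simp: ball_def)
    \<comment> \<open>The balls around \<open>C\<close> cover more than half of the vertices and
      have at most \<open>s\<close> points each, so \<open>C\<close> has at least
      \<open>n / (2 * s)\<close> points.\<close>
    then have "real (card A) \<le> card (\<Union>c\<in>C. ball c)"
      using C(3) by (simp add: card_mono)
    also have "\<dots> \<le> (\<Sum>c\<in>C. card (ball c))"
      using card_UN_le[OF finC] by (simp only: of_nat_le_iff)
    also have "\<dots> = (\<Sum>c\<in>C. real (card (ball c)))" by simp
    also have "\<dots> \<le> (\<Sum>c\<in>C. s)"
      using C(1) by (intro sum_mono) (auto simp: A_def)
    finally have "real n \<le> 2 * (card C * s)" using False by simp
    \<comment> \<open>This is where \<open>n \<ge> 16 * d\<close> enters: it gives
      \<open>card C \<ge> 2\<close>, so that passing to \<open>card C - 1\<close> costs at most a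
      factor 2.\<close>
    have "(4 * s)\<^sup>2 \<le> (real n)\<^sup>2"
      using s(2) mult_right_mono[of "real (16 * d)" "real n" "real n"] nd
      by (simp add: power2_eq_square)
    then have "4 * s \<le> n" by (rule power2_le_imp_le) simp
    then have "2 * s \<le> card C * s"
      using \<open>real n \<le> 2 * (card C * s)\<close> by linarith
    then have "card C \<ge> 2" using s(1) by simp
    then have "card C / 2 \<le> real (card C - 1)" by (simp add: of_nat_diff)
    then have "card C / 2 * s \<le> real (card C - 1) * s"
      using s(1) by (intro mult_right_mono) auto
    then have cardC: "n \<le> 4 * real (card C - 1) * s"
      using \<open>real n \<le> 2 * (card C * s)\<close> by linarith
    have "real d / 5 * (real d / 5) \<le> real \<rho> * real (\<rho> + 1)"
      using \<rho>(1) by (intro mult_mono) auto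
    also have "\<dots> = real (2 * (\<Sum>j\<le>\<rho>. j))"
      by (simp only: gauss_sum_twice of_nat_mult)
    finally have gauss: "real d * real d / 50 \<le> real (\<Sum>j\<le>\<rho>. j)" by simp
    \<comment> \<open>The extra factor \<open>s\<close> replaces division and is cancelled at the
      end. The constant 200 is 4 from \<open>cardC\<close> times 50 from
      \<open>gauss\<close>.\<close>
    have "x * s / 200 * s = real n * real n * (real d * real d / 200)"
      using s(2) x by (simp add: algebra_simps)
    also have "\<dots> \<le> real n * (4 * real (card C - 1) * s) * (real d * real d / 200)"
      using cardC by (intro mult_right_mono mult_left_mono) auto
    also have "\<dots> = real n * real (card C - 1) * (real d * real d / 50) * s" by simp
    also have "\<dots> \<le> real n * real (card C - 1) * real (\<Sum>j\<le>\<rho>. j) * s"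
      using gauss s(1) by (intro mult_right_mono mult_left_mono) auto
    finally have "x * s / 200 \<le> real n * real (card C - 1) * real (\<Sum>j\<le>\<rho>. j)"
      using s(1) by simp
    also have "\<dots> = real (\<Sum>r\<in>pverts G. (card C - 1) * (\<Sum>j\<le>\<rho>. j))"
      by (simp add: n_def)
    also have "\<dots> \<le> real (\<Sum>r\<in>pverts G. dist_deficit G r)"
      unfolding of_nat_le_iff using C(1,2) A(1)
      by (intro sum_mono dist_deficit_ge_separated) auto
    finally show ?thesis by (simp add: s_def)
  qed
qed

end

section \<open>Spiders\<close>

lemma (in pair_graph) connectedI:
  assumes "pverts G \<noteq> {}"
    and "\<And>u v. u \<in> pverts G \<Longrightarrow> v \<in> pverts G \<Longrightarrow> \<exists>p. awalk u p v"
  shows "connected (with_proj G)"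
  unfolding connected_def
proof (rule strongly_connectedI)
  fix u v assume "u \<in> verts (with_proj (mk_symmetric (with_proj G)))"
    "v \<in> verts (with_proj (mk_symmetric (with_proj G)))"
  then have "u \<rightarrow>\<^sup>*\<^bsub>with_proj G\<^esub> v"
    using assms(2) by (simp add: reachable_awalk)
  then show "u \<rightarrow>\<^sup>*\<^bsub>with_proj (mk_symmetric (with_proj G))\<^esub> v"
    by (rule reachable_mk_symmetricI)
qed (use assms in simp)

lemma length_rev_path [simp]: "length (rev_path p) = length p"
  by (induction p) auto

text \<open>Vertices are numbered level by level, \<open>k\<close> to a level; the minimum puts all
  vertices from \<open>k * h\<close> on into level \<open>h\<close>.\<close>

definition spider_level :: "nat \<Rightarrow> nat \<Rightarrow> nat \<Rightarrow> nat" where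
  "spider_level k h x = min (x div k) h"

text \<open>
  Vertex \<open>x\<close> lies on leg \<open>x mod k\<close> of a spider with \<open>k\<close> legs of length \<open>h\<close>, all surplus vertices
  being leaves at the last level. The feet \<open>x < k\<close> of the legs form a clique if \<open>e\<close> holds and a star
  centred at \<open>0\<close> otherwise; this gives the odd and the even diameters, respectively.
\<close>
definition spider :: "bool \<Rightarrow> nat \<Rightarrow> nat \<Rightarrow> nat \<Rightarrow> nat pair_pre_digraph" where
  "spider e n k h = \<lparr>pverts = {..<n}, parcs = {(x, y). x < n \<and> y < n \<and> x \<noteq> y \<and>
     (x mod k = y mod k \<and> (spider_level k h x = Suc (spider_level k h y)
        \<or> spider_level k h y = Suc (spider_level k h x))
      \<or> x < k \<and> y < k \<and> (e \<or> x = 0 \<or> y = 0))}\<rparr>"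

lemma pair_graph_spider: "pair_graph (spider e n k h)"
proof -
  have "finite (parcs (spider e n k h))"
    by (rule finite_subset[of _ "{..<n} \<times> {..<n}"]) (auto simp: spider_def)
  then show ?thesis
    by unfold_locales (auto simp: spider_def symmetric_def intro!: symI)
qed

text \<open>Three legs leave two besides the one through the centre \<open>0\<close>. The last
  condition excludes isolated vertices: for \<open>h = 0\<close> a vertex that is not a foot would
  have no neighbour.\<close>

locale spider_params =
  fixes e :: bool and n k h :: nat
  assumes k: "k \<ge> 3" and n: "k * (h + 1) \<le> n" and short: "h = 0 \<Longrightarrow> n = k"
begin

abbreviation G where "G \<equiv> spider e n k h"
abbreviation level where "level \<equiv> spider_level k h"
abbreviation diam :: nat where "diam \<equiv> 2 * h + (if e then 1 else 2)"

sublocale G: pair_graph G by (rule pair_graph_spider)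

lemma pverts_G [simp]: "pverts G = {..<n}"
  by (simp add: spider_def)

lemma parcs_G: "(x, y) \<in> parcs G \<longleftrightarrow> x < n \<and> y < n \<and> x \<noteq> y \<and>
    (x mod k = y mod k \<and> (level x = Suc (level y) \<or> level y = Suc (level x))
      \<or> x < k \<and> y < k \<and> (e \<or> x = 0 \<or> y = 0))"
  by (simp add: spider_def)

lemma k_le_n: "k \<le> n"
  using n by simp

lemma level_le: "level x \<le> h"
  by (simp add: spider_level_def)

section \<open>Walks in spiders and the upper bound for the diameter\<close>

lemma ex_walk_to_foot:
  assumes "x < n"
  shows "\<exists>p. G.awalk x p (x mod k) \<and> length p \<le> level x"
  using assms
proof (induction "level x" arbitrary: x rule: less_induct)
  case less
  show ?case
  proof (cases "x < k")
    case True
    then show ?thesis using less.prems by (intro exI[of _ "[]"]) (simp add: G.awalk_simps)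
  next
    case False
    with short less.prems have "h > 0" by (cases h) auto
    moreover have "x div k > 0" using False k by (simp add: div_greater_zero_iff)
    ultimately have lev: "level x > 0" by (simp add: spider_level_def)
    \<comment> \<open>The vertex one level closer to the foot on the same leg; it is below level
      \<open>h\<close>, so the minimum in \<open>spider_level\<close> has no effect on it.\<close>
    define y where "y = x mod k + k * (level x - 1)"
    have mod_less: "x mod k < k" using k by simp
    have y_mod: "y mod k = x mod k" by (simp add: y_def)
    have "y div k = level x - 1" using mod_less by (simp add: y_def)
    then have y_lev: "level x = Suc (level y)"
      using lev level_le[of x] by (simp add: spider_level_def[of k h y])
    have "k * level x \<le> k * h" using level_le by simp
    moreover have "y < k * level x" using mod_less lev by (cases "level x") (auto simp: y_def)
    moreover have "k * h \<le> n" using n by simp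
    ultimately have "y < n" by linarith
    with less y_lev obtain p where "G.awalk y p (x mod k)" "length p \<le> level y"
      by (metis lessI y_mod)
    moreover have "(x, y) \<in> parcs G"
      using less.prems \<open>y < n\<close> y_mod y_lev by (auto simp: parcs_G)
    ultimately show ?thesis
      using y_lev by (intro exI[of _ "(x, y) # p"]) (simp add: G.awalk_simps)
  qed
qed

lemma ex_walk_between_feet:
  assumes "x < k" "y < k"
  shows "\<exists>p. G.awalk x p y \<and> length p \<le> (if e then 1 else 2)"
proof -
  consider "x = y" | "x \<noteq> y" "e \<or> x = 0 \<or> y = 0" | "\<not> e" "x \<noteq> 0" "y \<noteq> 0" by blast
  then show ?thesis
  proof cases
    case 1
    then show ?thesis using assms k_le_n by (intro exI[of _ "[]"]) (simp add: G.awalk_simps)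
  next
    case 2
    then show ?thesis using assms k_le_n
      by (intro exI[of _ "[(x, y)]"]) (simp add: G.awalk_simps parcs_G)
  next
    case 3
    then have "(x, 0) \<in> parcs G" "(0, y) \<in> parcs G"
      unfolding parcs_G using assms k_le_n by simp_all
    then have "G.awalk x [(x, 0), (0, y)] y"
      using assms k_le_n by (simp add: G.awalk_simps)
    with 3 show ?thesis by fastforce
  qed
qed

lemma ex_short_walk:
  assumes "x < n" "y < n"
  shows "\<exists>p. G.awalk x p y \<and> length p \<le> diam"
proof -
  obtain p where p: "G.awalk x p (x mod k)" "length p \<le> level x"
    using ex_walk_to_foot assms by blast
  obtain q where q: "G.awalk y q (y mod k)" "length q \<le> level y"
    using ex_walk_to_foot assms by blast
  obtain r where r: "G.awalk (x mod k) r (y mod k)" "length r \<le> (if e then 1 else 2)"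
    using ex_walk_between_feet[of "x mod k" "y mod k"] k by auto
  have "G.awalk x (p @ r @ rev_path q) y"
    using p(1) q(1) r(1) by (intro G.awalk_appendI) simp_all
  moreover have "length (p @ r @ rev_path q) \<le> diam"
    using p(2) q(2) r(2) level_le[of x] level_le[of y] by simp
  ultimately show ?thesis by blast
qed

sublocale G: connected_pair_graph G
proof
  show "connected (with_proj G)"
  proof (rule G.connectedI)
    have "0 \<in> pverts G" using k k_le_n by simp
    then show "pverts G \<noteq> {}" by blast
    show "\<exists>p. G.awalk u p v" if "u \<in> pverts G" "v \<in> pverts G" for u v
      using ex_short_walk[of u v] that by auto
  qed
qed

text \<open>A potential \<open>f\<close> climbs from 0 at \<open>x\<close> to \<open>h\<close> at
  the foot of its leg, to \<open>h + c\<close> at the foot of the leg of \<open>y\<close>, and on to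
  \<open>diam\<close> at \<open>y\<close>. In the star case leg \<open>0\<close> is excluded because
  its leaves are one step closer to the other legs.\<close>

lemma graph_dist_leaves:
  assumes x: "x < n" "level x = h" and y: "y < n" "level y = h"
    and legs: "x mod k \<noteq> y mod k" "e \<or> x mod k \<noteq> 0 \<and> y mod k \<noteq> 0"
  shows "diam \<le> graph_dist G x y"
proof -
  define c :: nat where "c = (if e then 1 else 2)"
  \<comment> \<open>On the remaining legs \<open>h + 1\<close> is within 1 of both feet values
    \<open>h\<close> and \<open>h + c\<close>. For a star this covers the centre, through which
    every walk between the two feet passes.\<close>
  define f where "f v = (if v mod k = x mod k then h - level v
    else if v mod k = y mod k then h + c + level v else h + 1)" for v
  have "f b \<le> f a + 1" if ab: "(a, b) \<in> parcs G" for a b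
  proof (cases "a mod k = b mod k \<and> (level a = Suc (level b) \<or> level b = Suc (level a))")
    case True
    then show ?thesis using level_le[of a] level_le[of b] by (auto simp: f_def)
  next
    case False
    then have *: "a < k" "b < k" "e \<or> a = 0 \<or> b = 0" using ab by (auto simp: parcs_G)
    then have "level a = 0" "level b = 0" by (simp_all add: spider_level_def)
    then show ?thesis using * legs by (auto simp: f_def c_def)
  qed
  moreover obtain p where "G.awalk x p y" "length p = graph_dist G x y"
    using G.ex_shortest_awalk[of x y] x y by auto
  ultimately have "f y \<le> f x + graph_dist G x y"
    using G.lipschitz_awalk[of x p y f] by simp
  moreover have "f x = 0" "f y = diam" using x y legs by (auto simp: f_def c_def)
  ultimately show ?thesis by simp
qed

lemma diameter_G: "diameter G = diam"
proof (rule G.diameter_eqI)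
  show "graph_dist G u v \<le> diam" if "u \<in> pverts G" "v \<in> pverts G" for u v
    using ex_short_walk[of u v] G.graph_dist_le_length[of u _ v] that
    by (metis lessThan_iff order_trans pverts_G)
  \<comment> \<open>The witnesses lie at level \<open>h\<close> on the legs 1 and 2, which avoid the
    centre's leg.\<close>
  have lt: "h * k + 1 < n" "h * k + 2 < n" using n k by (simp_all add: algebra_simps)
  then show "h * k + 1 \<in> pverts G" "h * k + 2 \<in> pverts G" by simp_all
  have legs: "(h * k + 1) mod k = 1" "(h * k + 2) mod k = 2"
    using k by (simp_all only: mod_mult_self3) simp_all
  have "(h * k + 1) div k = h" "(h * k + 2) div k = h"
    using k by (simp_all only: div_mult_self3) simp_all
  then have "level (h * k + 1) = h" "level (h * k + 2) = h"
    unfolding spider_level_def by (simp_all only: min.idem)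
  then show "diam \<le> graph_dist G (h * k + 1) (h * k + 2)"
    by (intro graph_dist_leaves lt) (simp_all only: legs, simp_all)
qed

lemma spider_in_graphs_of: "G \<in> graphs_of n diam"
  unfolding graphs_of_def using G.pair_graph G.connected diameter_G by simp

text \<open>Two vertices at level \<open>h\<close> on different legs other than leg \<open>0\<close>
  have deficit 0. Vertices below level \<open>h\<close> or on leg \<open>0\<close> are
  \<open>bad\<close> and get the trivial bound \<open>diam * n\<close>; any other vertex has a
  deficit only towards \<open>bad\<close> and its own leg.\<close>

lemma sum_dist_deficit_le:
  "(\<Sum>v\<in>pverts G. dist_deficit G v) \<le> diam * n * (2 * (k * h) + 3 * (n div k + 1))"
proof -
  define L where "L = {u. u < n \<and> u div k < h}"
  define leg where "leg a = {u. u < n \<and> u mod k = a}" for a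
  \<comment> \<open>Leg \<open>0\<close> is discarded for clique spiders too, so that both parities
    are treated alike.\<close>
  define bad where "bad = L \<union> leg 0"
  have fin: "finite L" "finite (leg a)" "finite bad" for a by (simp_all add: L_def leg_def bad_def)
  have bad: "bad \<subseteq> {..<n}" by (auto simp: bad_def L_def leg_def)
  have "L \<subseteq> {..<k * h}"
    using k by (auto simp: L_def div_less_iff_less_mult mult.commute)
  from card_mono[OF _ this] have cardL: "card L \<le> k * h" by simp
  have card_leg: "card (leg a) \<le> n div k + 1" for a
  proof -
    have "inj_on (\<lambda>u. u div k) (leg a)"
      by (rule inj_onI) (metis (mono_tags, lifting) leg_def mem_Collect_eq mult_div_mod_eq)
    moreover have "(\<lambda>u. u div k) ` leg a \<subseteq> {..n div k}"
      by (auto simp: leg_def div_le_mono)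
    ultimately have "card (leg a) \<le> card {..n div k}"
      by (rule card_inj_on_le) simp
    then show ?thesis by simp
  qed
  have card_bad: "card bad \<le> k * h + (n div k + 1)"
    unfolding bad_def using card_Un_le[of L "leg 0"] cardL card_leg[of 0] by linarith
  have deficit_le: "dist_deficit G v \<le> diam * card B"
    if "B \<subseteq> {..<n}" "\<And>u. u < n \<Longrightarrow> u \<notin> B \<Longrightarrow> diam \<le> graph_dist G u v" for v B
  proof -
    have "dist_deficit G v = (\<Sum>u\<in>B. diam - graph_dist G u v)"
      unfolding dist_deficit_def diameter_G using that
      by (intro sum.mono_neutral_right) auto
    also have "\<dots> \<le> (\<Sum>u\<in>B. diam)" by (rule sum_mono) simp
    finally show ?thesis by (simp add: mult.commute)
  qed
  have deficit_le_good: "dist_deficit G v \<le> diam * (k * h + 2 * (n div k + 1))" if v: "v \<in> {..<n} - bad" for v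
  proof -
    have "dist_deficit G v \<le> diam * card (bad \<union> leg (v mod k))"
    proof (rule deficit_le)
      show "bad \<union> leg (v mod k) \<subseteq> {..<n}" by (auto simp: bad_def L_def leg_def)
      show "diam \<le> graph_dist G u v" if "u < n" "u \<notin> bad \<union> leg (v mod k)" for u
        using that v by (intro graph_dist_leaves) (auto simp: bad_def L_def leg_def spider_level_def)
    qed
    also have "card (bad \<union> leg (v mod k)) \<le> k * h + 2 * (n div k + 1)"
      using card_Un_le[of bad "leg (v mod k)"] card_bad card_leg[of "v mod k"]
      unfolding mult_2 by linarith
    finally show ?thesis by simp
  qed
  have good: "(\<Sum>v\<in>{..<n} - bad. dist_deficit G v) \<le> n * (diam * (k * h + 2 * (n div k + 1)))"
  proof -
    have "(\<Sum>v\<in>{..<n} - bad. dist_deficit G v)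
        \<le> card ({..<n} - bad) * (diam * (k * h + 2 * (n div k + 1)))"
      using deficit_le_good sum_bounded_above[of "{..<n} - bad" "dist_deficit G"] by simp
    also have "card ({..<n} - bad) \<le> n"
      using card_mono[of "{..<n}" "{..<n} - bad"] by simp
    finally show ?thesis by (simp add: mult_right_mono)
  qed
  have "(\<Sum>v\<in>bad. dist_deficit G v) \<le> card bad * (diam * n)"
    using sum_bounded_above[of bad "dist_deficit G" "diam * n"] deficit_le[of "{..<n}"] by simp
  also have "\<dots> \<le> (k * h + (n div k + 1)) * (diam * n)"
    using card_bad by (rule mult_right_mono) simp
  finally have "(\<Sum>v\<in>bad. dist_deficit G v) + (\<Sum>v\<in>{..<n} - bad. dist_deficit G v)
      \<le> (k * h + (n div k + 1)) * (diam * n) + n * (diam * (k * h + 2 * (n div k + 1)))"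
    using good by (rule add_mono)
  also have "(\<Sum>v\<in>bad. dist_deficit G v) + (\<Sum>v\<in>{..<n} - bad. dist_deficit G v)
      = (\<Sum>v\<in>pverts G. dist_deficit G v)"
    using sum.subset_diff[of bad "{..<n}" "dist_deficit G"] bad by (simp add: add.commute)
  finally show ?thesis by (simp add: algebra_simps)
qed

end

lemma star_spider:
  assumes "n \<ge> 3"
  shows "K\<^bsub>1,n - 1\<^esub> (with_proj (spider False n n 0))"
  unfolding complete_bipartite_digraph_pair_def
proof (intro conjI exI)
  show "pverts (spider False n n 0) = {0} \<union> {1..<n}" "parcs (spider False n n 0) = {0} \<times> {1..<n} \<union> {1..<n} \<times> {0}"
    using assms by (auto simp: spider_def spider_level_def)
qed (auto simp: spider_def)

section \<open>Maximum Wiener index\<close>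

text \<open>A crude bound that makes the set of values finite, as \<open>Max\<close>
  requires.\<close>

lemma wiener_index_le:
  assumes "G \<in> graphs_of n d"
  shows "wiener_index G \<le> d * n\<^sup>2"
proof -
  interpret connected_pair_graph G
    using assms by (simp add: graphs_of_def connected_pair_graph_def connected_pair_graph_axioms_def)
  show ?thesis using sum_dist_deficit assms by (simp add: graphs_of_def)
qed

lemma finite_wiener_index_graphs_of: "finite (wiener_index ` graphs_of n d)"
  by (rule finite_subset[of _ "{..d * n\<^sup>2}"]) (auto intro: wiener_index_le)

lemma wiener_index_le_max_wiener:
  fixes G :: "nat pair_pre_digraph"
  shows "G \<in> graphs_of n d \<Longrightarrow> wiener_index G \<le> max_wiener n d"
  unfolding max_wiener_def by (intro Max_ge finite_wiener_index_graphs_of) simp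

text \<open>The graph \<open>G\<close> guarantees that the maximum is taken over a nonempty
  set.\<close>

lemma max_wiener_attained:
  fixes G :: "nat pair_pre_digraph"
  assumes "G \<in> graphs_of n d"
  obtains H :: "nat pair_pre_digraph" where "H \<in> graphs_of n d" "wiener_index H = max_wiener n d"
proof -
  have "wiener_index ` (graphs_of n d :: nat pair_pre_digraph set) \<noteq> {}"
    using assms by auto
  from Max_in[OF finite_wiener_index_graphs_of this] show thesis
    using that unfolding max_wiener_def by auto
qed

lemma wiener_index_diameter_2_le:
  fixes G :: "'a pair_pre_digraph"
  assumes "n \<ge> 3" "G \<in> graphs_of n 2"
  shows "wiener_index G \<le> (n - 1)\<^sup>2"
    and "wiener_index G = (n - 1)\<^sup>2 \<longleftrightarrow> K\<^bsub>1,n - 1\<^esub> (with_proj G)"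
proof -
  interpret connected_pair_graph G
    using assms by (simp add: graphs_of_def connected_pair_graph_def connected_pair_graph_axioms_def)
  have G: "card (pverts G) = n" "diameter G = 2"
    using assms by (simp_all add: graphs_of_def)
  obtain m where m: "n = Suc m" using assms by (cases n) auto
  \<comment> \<open>Given this identity, the bound and the equality case both come down to
    \<open>card (parcs G) \<ge> 2 * m\<close>, with equality exactly for stars.\<close>
  have eq: "2 * wiener_index G + card (parcs G) = 2 * m\<^sup>2 + 2 * m"
    using wiener_index_diameter_2[OF G(2)] G(1) m by (simp add: power2_eq_square)
  have ge: "2 * m \<le> card (parcs G)"
    using card_parcs_ge G(1) m by simp
  show "wiener_index G \<le> (n - 1)\<^sup>2" using eq ge m by simp
  show "wiener_index G = (n - 1)\<^sup>2 \<longleftrightarrow> K\<^bsub>1,n - 1\<^esub> (with_proj G)"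
  proof
    assume "wiener_index G = (n - 1)\<^sup>2"
    then have "card (parcs G) = 2 * m" using eq m by simp
    then show "K\<^bsub>1,n - 1\<^esub> (with_proj G)" using star_if_few_arcs G m by simp
  next
    assume "K\<^bsub>1,n - 1\<^esub> (with_proj G)"
    then have "card (parcs G) = 2 * m" using card_parcs_complete_bipartite m by fastforce
    then show "wiener_index G = (n - 1)\<^sup>2" using eq m by simp
  qed
qed

lemma max_wiener_diameter_2:
  assumes "n \<ge> 3"
  shows "max_wiener n 2 = (n - 1)\<^sup>2"
proof (rule antisym)
  interpret spider_params False n n 0
    using assms by unfold_locales auto
  have star: "spider False n n 0 \<in> graphs_of n 2"
    using spider_in_graphs_of by (simp flip: numeral_2_eq_2)
  show "(n - 1)\<^sup>2 \<le> max_wiener n 2"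
    using wiener_index_le_max_wiener[OF star] wiener_index_diameter_2_le(2)[OF assms star]
      star_spider[OF assms] by simp
  obtain H :: "nat pair_pre_digraph" where "H \<in> graphs_of n 2" "wiener_index H = max_wiener n 2"
    using max_wiener_attained[OF star] by blast
  then show "max_wiener n 2 \<le> (n - 1)\<^sup>2"
    using wiener_index_diameter_2_le(1)[OF assms] by metis
qed

section \<open>Two-sided bounds for diameter at least 3\<close>

lemma wiener_deficit_ge:
  assumes "G \<in> graphs_of n d" "d \<ge> 3" "n \<ge> 16 * d"
  shows "real d * real n * sqrt (real d * real n) / 400 \<le> d / 2 * (real n)\<^sup>2 - wiener_index G"
proof -
  interpret connected_pair_graph G
    using assms by (simp add: graphs_of_def connected_pair_graph_def connected_pair_graph_axioms_def)
  have G: "card (pverts G) = n" "diameter G = d"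
    using assms by (simp_all add: graphs_of_def)
  have "real (\<Sum>v\<in>pverts G. dist_deficit G v) + 2 * real (wiener_index G) = d * (real n)\<^sup>2"
    using arg_cong[OF sum_dist_deficit, of real] G by simp
  then show ?thesis
    using sum_dist_deficit_ge assms(2,3) G by (simp add: mult.commute)
qed

lemma ex_wiener_deficit_le:
  assumes d: "d \<ge> 3" and n: "n \<ge> 16 * d"
  shows "\<exists>G :: nat pair_pre_digraph. G \<in> graphs_of n d
    \<and> d / 2 * (real n)\<^sup>2 - wiener_index G \<le> 3 * (real d * real n * sqrt (real d * real n))"
proof -
  \<comment> \<open>With a clique of feet for odd \<open>d\<close> and a star for even
    \<open>d\<close>, this leg length yields diameter exactly \<open>d\<close>.\<close>
  define h where "h = (d - 1) div 2"
  \<comment> \<open>About \<open>q\<close> legs balance the two error terms: \<open>k * d\<close>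
    for the vertices along the legs and \<open>n / k\<close> for the size of a leg are then both of
    order \<open>s\<close>.\<close>
  define q where "q = sqrt (real n / real d)"
  define k where "k = nat \<lceil>q\<rceil>"
  define s where "s = sqrt (real d * real n)"
  have dh: "2 * h + (if odd d then 1 else 2) = d" "h \<noteq> 0" "h + 1 \<le> d" "2 * h \<le> d"
    using d unfolding h_def by (auto elim!: oddE evenE)
  have "4\<^sup>2 \<le> real n / d" using n d by (simp add: field_simps)
  then have q: "4 \<le> q" unfolding q_def by (rule real_le_rsqrt)
  have kq: "q \<le> k" "k \<le> 2 * q" using q unfolding k_def by linarith+
  have qs: "q * d = s" "q * s = n" "n / q = s"
    using d n by (simp_all add: q_def s_def real_sqrt_divide real_sqrt_mult field_simps)
  have s: "3 \<le> s" "2 * s \<le> n"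
    using qs(1,2) q d mult_mono[of 1 q 3 "real d"] mult_right_mono[of 2 q s]
    by (auto simp: s_def)
  have "real (k * (h + 1)) \<le> 2 * q * d"
    unfolding of_nat_mult using kq(2) dh(3) q by (intro mult_mono) auto
  also have "\<dots> \<le> n" using qs(1) s(2) by simp
  finally have kh: "k * (h + 1) \<le> n" by (simp only: of_nat_le_iff)
  interpret spider_params "odd d" n k h
    using kh kq(1) q dh(2) by unfold_locales auto
  have G: "G \<in> graphs_of n d"
    using spider_in_graphs_of dh(1) by simp
  have "real (2 * (k * h)) \<le> k * real d"
    using dh(4) by (simp add: mult_left_mono flip: of_nat_mult)
  also have "\<dots> \<le> 2 * q * d" using kq(2) by (intro mult_right_mono) auto
  finally have 1: "real (2 * (k * h)) \<le> 2 * s" using qs(1) by simp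
  have "real (n div k) \<le> n / k" by (rule of_nat_div_le_of_nat)
  also have "\<dots> \<le> n / q" using kq(1) q by (intro divide_left_mono) auto
  finally have 2: "real (n div k) \<le> s" using qs(3) by simp
  have "real (\<Sum>v\<in>pverts G. dist_deficit G v) \<le> real (d * n * (2 * (k * h) + 3 * (n div k + 1)))"
    using sum_dist_deficit_le dh(1) by (simp only: of_nat_le_iff)
  also have "\<dots> = real d * real n * (real (2 * (k * h)) + 3 * (n div k) + 3)" by simp
  \<comment> \<open>The sum \<open>2 * s + 3 * s + 3\<close> is at most \<open>6 * s\<close> because
    \<open>s \<ge> 3\<close>.\<close>
  also have "\<dots> \<le> real d * real n * (6 * s)"
    using 1 2 s(1) by (intro mult_left_mono) auto
  finally have "real (\<Sum>v\<in>pverts G. dist_deficit G v) \<le> 6 * (real d * real n * s)" by simp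
  moreover have "real (\<Sum>v\<in>pverts G. dist_deficit G v) + 2 * real (wiener_index G) = d * (real n)\<^sup>2"
    using arg_cong[OF G.sum_dist_deficit, of real] diameter_G dh(1) by simp
  ultimately have "d / 2 * (real n)\<^sup>2 - wiener_index G \<le> 3 * (real d * real n * s)" by simp
  with G show ?thesis unfolding s_def by blast
qed

lemma powr_three_halves: "real m powr (3 / 2) = m * sqrt m"
proof (cases "m = 0")
  case False
  then have "real m powr (1 + 1 / 2) = m * sqrt m"
    by (simp only: powr_add powr_half_sqrt of_nat_0_le_iff) simp
  then show ?thesis by simp
qed simp

theorem theorem3p1:
  shows "(\<forall>n\<ge>3. max_wiener n 2 = (n - 1)\<^sup>2 \<and>
            (\<forall>G :: 'a pair_pre_digraph. G \<in> graphs_of n 2 \<longrightarrow>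
               (wiener_index G = (n - 1)\<^sup>2 \<longleftrightarrow> K\<^bsub>1,n - 1\<^esub> (with_proj G))))
    \<and> (\<exists>c1 c2 :: real. c1 \<ge> c2 \<and> c2 > 0 \<and>
         (\<forall>d::nat\<ge>3. \<forall>\<^sub>F n :: nat in sequentially.
            c2 * real d powr (3/2) * real n powr (3/2)
              \<le> real d / 2 * (real n)\<^sup>2 - real (max_wiener n d) \<and>
            real d / 2 * (real n)\<^sup>2 - real (max_wiener n d)
              \<le> c1 * real d powr (3/2) * real n powr (3/2)))"
proof (rule conjI)
  show "\<forall>n\<ge>3. max_wiener n 2 = (n - 1)\<^sup>2 \<and> (\<forall>G :: 'a pair_pre_digraph. G \<in> graphs_of n 2 \<longrightarrow>
      (wiener_index G = (n - 1)\<^sup>2 \<longleftrightarrow> K\<^bsub>1,n - 1\<^esub> (with_proj G)))"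
    using max_wiener_diameter_2 wiener_index_diameter_2_le(2) by blast
next
  have asymp: "\<forall>\<^sub>F n :: nat in sequentially.
      1 / 400 * real d powr (3/2) * real n powr (3/2)
        \<le> real d / 2 * (real n)\<^sup>2 - real (max_wiener n d) \<and>
      real d / 2 * (real n)\<^sup>2 - real (max_wiener n d)
        \<le> 3 * real d powr (3/2) * real n powr (3/2)" if d: "d \<ge> 3" for d :: nat
  proof (rule eventually_sequentiallyI[of "16 * d"], rule conjI)
    fix n assume n: "n \<ge> 16 * d"
    have powr: "c * real d powr (3/2) * real n powr (3/2) = c * (real d * real n * sqrt (real d * real n))" for c
      by (simp add: powr_three_halves real_sqrt_mult)
    obtain G :: "nat pair_pre_digraph" where G: "G \<in> graphs_of n d"
      "d / 2 * (real n)\<^sup>2 - wiener_index G \<le> 3 * (real d * real n * sqrt (real d * real n))"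
      using ex_wiener_deficit_le[OF d n] by metis
    show "real d / 2 * (real n)\<^sup>2 - real (max_wiener n d)
        \<le> 3 * real d powr (3/2) * real n powr (3/2)"
      unfolding powr using wiener_index_le_max_wiener[OF G(1)] G(2) by linarith
    \<comment> \<open>The spider bounds the maximum from below; the bound in the other direction
      holds for every graph and is applied to a maximiser.\<close>
    obtain H :: "nat pair_pre_digraph" where H: "H \<in> graphs_of n d" "wiener_index H = max_wiener n d"
      using max_wiener_attained[OF G(1)] by blast
    show "1 / 400 * real d powr (3/2) * real n powr (3/2)
        \<le> real d / 2 * (real n)\<^sup>2 - real (max_wiener n d)"
      unfolding powr using wiener_deficit_ge[OF H(1) d n] H(2) by linarith
  qed
  show "\<exists>c1 c2 :: real. c1 \<ge> c2 \<and> c2 > 0 \<and>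
         (\<forall>d::nat\<ge>3. \<forall>\<^sub>F n :: nat in sequentially.
            c2 * real d powr (3/2) * real n powr (3/2)
              \<le> real d / 2 * (real n)\<^sup>2 - real (max_wiener n d) \<and>
            real d / 2 * (real n)\<^sup>2 - real (max_wiener n d)
              \<le> c1 * real d powr (3/2) * real n powr (3/2))"
    by (rule exI[of _ 3], rule exI[of _ "1 / 400"], intro conjI allI impI asymp) simp_all
qed

end
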